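(* Let $\{(\widetilde H^{(k)},\alpha^{(k)})\}_{k\ge0}$ be the sequence generated by the alternating descent method with backtracking described in the context, and assume that for each $k\ge0$ the entries of $\alpha^{(k)}$ are distinct. Then the sequence $\{\mathcal{E}(\widetilde H^{(k)},\alpha^{(k)})\}_k$ of energy values is decreasing, i.e. $\mathcal{E}(\widetilde H^{(k+1)},\alpha^{(k+1)})\le\mathcal{E}(\widetilde H^{(k)},\alpha^{(k)})$ for all $k\ge0$. Consequently, it is convergent as $k\to\infty$.
   Context: Let $N,M,R$ be positive integers, $t_1<\dots<t_N$ real numbers, $H\in\mathbb{R}^{N\times M}$ a given matrix, and $\eta>0$. For $\alpha\in\mathbb{C}^R$, $\Phi(\alpha)\in\mathbb{C}^{N\times R}$ has entries $\Phi(\alpha)_{nr}=e^{\alpha_r t_n}$. $A^{\dagger}$ is the Moore--Penrose pseudoinverse, $A^*$ the Hermitian transpose, $\|\cdot\|_F$ the Frobenius norm. Define $$\mathcal{S}_H=\{K\in\mathbb{R}^{N\times M}: K_{nm}H_{nm}\ge 0\text{ if }H_{nm}\ne0,\ K_{nm}=0\text{ if }H_{nm}=0\},$$ $$\mathcal{S}_H^{\circ}=\{K\in\mathbb{R}^{N\times M}: K_{nm}H_{nm}> 0\text{ if }H_{nm}\ne0,\ K_{nm}=0\text{ if }H_{nm}=0\},$$ and, for $\widetilde H\in\mathcal{S}_H$, $\alpha\in\mathbb{C}^R$, $$\mathcal{E}(\widetilde H,\alpha)=\sum_{H_{nm}\neq 0}\left(\log|\widetilde H_{nm}|+\frac{H_{nm}}{\widetilde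 H_{nm}}\right)+\frac{\eta}{2}\|\widetilde H-\Phi(\alpha)\Phi(\alpha)^{\dagger}\widetilde H\|_F^2,$$ with the sum over index pairs with $H_{nm}\ne0$ and $\mathcal{E}(\widetilde H,\alpha)=+\infty$ if $\widetilde H\in\mathcal{S}_H\setminus\mathcal{S}_H^{\circ}$. Gradients: $\nabla_{\widetilde H}\mathcal{E}(\widetilde H,\alpha)=D(\widetilde H)+\eta\,\mathrm{Re}(\widetilde H-\Phi(\alpha)\Phi(\alpha)^{\dagger}\widetilde H)$ for $\widetilde H\in\mathcal{S}_H^\circ$, where $D(\widetilde H)_{nm}=\frac{1}{\widetilde H_{nm}}-\frac{H_{nm}}{\widetilde H_{nm}^2}$ if $H_{nm}\neq0$ and $0$ otherwise; $\nabla_{\alpha}\mathcal{E}=2\left(\frac{\partial\mathcal{E}}{\partial\alpha}\right)^{*}$ is the complex gradient, where $\partial\mathcal{E}/\partial\alpha$ is the (row vector) Wirtinger derivative with respect to $\alpha$ with $\bar\alpha$ held constant. $\mathrm{proj}_{\mathcal{S}_H}$ is the orthogonal projection onto $\mathcal{S}_H$. Alternating descent method: choose $\widetilde H^{(0)}\in\mathcal{S}_H^{\circ}$, $\alpha^{(0)}\in\mathbb{C}^R$, $\tau_{\widetilde H}>0$, $\tau_\alpha>0$. For $k=0,1,2,\dots$: (i) Replace $\tau_{\widetilde H}$ by $2\tau_{\widetilde H}$. Then repeat: set $\widetilde H^{(k+1)}=\mathrm{proj}_{\mathcal{S}_H}(\widetilde H^{(k)}-\tau_{\widetilde H}\nabla_{\widetilde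 H}\mathcal{E}(\widetilde H^{(k)},\alpha^{(k)}))$; if $\mathcal{E}(\widetilde H^{(k+1)},\alpha^{(k)})>\mathcal{E}(\widetilde H^{(k)},\alpha^{(k)})-\frac{1}{2\tau_{\widetilde H}}\|\widetilde H^{(k+1)}-\widetilde H^{(k)}\|_F^2$, replace $\tau_{\widetilde H}$ by $\tau_{\widetilde H}/2$ and try again; otherwise stop (accept $\widetilde H^{(k+1)}$). (ii) Replace $\tau_\alpha$ by $2\tau_\alpha$. Then repeat: set $\alpha^{(k+1)}=\alpha^{(k)}-\tau_\alpha\nabla_\alpha\mathcal{E}(\widetilde H^{(k+1)},\alpha^{(k)})$; if $\mathcal{E}(\widetilde H^{(k+1)},\alpha^{(k+1)})>\mathcal{E}(\widetilde H^{(k+1)},\alpha^{(k)})-\frac{1}{2\tau_\alpha}\|\alpha^{(k+1)}-\alpha^{(k)}\|_2^2$, replace $\tau_\alpha$ by $\tau_\alpha/2$ and try again; otherwise stop (accept $\alpha^{(k+1)}$). The step sizes are carried over from one iteration to the next. *)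

theory Defs
  imports "HOL-Analysis.Analysis"
begin

text \<open>An \<open>N \<times> M\<close> matrix has type \<^typ>\<open>'a^'m^'n\<close> with \<open>CARD('n) = N\<close>, \<open>CARD('m) = M\<close>. On these
  types \<^const>\<open>norm\<close> is the Frobenius norm and \<^const>\<open>dist\<close> the induced distance.\<close>

definition hermitian_transpose :: "complex^'m^'n \<Rightarrow> complex^'n^'m" where
  "hermitian_transpose A = (\<chi> i j. cnj (A $ j $ i))"

text \<open>The Penrose conditions have exactly one solution, for every matrix.\<close>

definition is_moore_penrose :: "complex^'m^'n \<Rightarrow> complex^'n^'m \<Rightarrow> bool" where
  "is_moore_penrose A X \<longleftrightarrow>
     A ** X ** A = A \<and> X ** A ** X = X \<and>
     hermitian_transpose (A ** X) = A ** X \<and> hermitian_transpose (X ** A) = X ** A"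

definition pseudoinverse :: "complex^'m^'n \<Rightarrow> complex^'n^'m" where
  "pseudoinverse A = (THE X. is_moore_penrose A X)"

definition Phi :: "('n::finite \<Rightarrow> real) \<Rightarrow> complex^'r \<Rightarrow> complex^'r^'n" where
  "Phi t \<alpha> = (\<chi> n r. exp (\<alpha> $ r * of_real (t n)))"

definition cmatrix :: "real^'m^'n \<Rightarrow> complex^'m^'n" where
  "cmatrix K = (\<chi> n m. of_real (K $ n $ m))"

definition sign_set :: "real^'m^'n \<Rightarrow> (real^'m^'n) set" where
  "sign_set H = {K. \<forall>n m. (H $ n $ m \<noteq> 0 \<longrightarrow> K $ n $ m * H $ n $ m \<ge> 0) \<and>
                          (H $ n $ m = 0 \<longrightarrow> K $ n $ m = 0)}"

definition strict_sign_set :: "real^'m^'n \<Rightarrow> (real^'m^'n) set" where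
  "strict_sign_set H = {K. \<forall>n m. (H $ n $ m \<noteq> 0 \<longrightarrow> K $ n $ m * H $ n $ m > 0) \<and>
                                 (H $ n $ m = 0 \<longrightarrow> K $ n $ m = 0)}"

definition residual :: "('n::finite \<Rightarrow> real) \<Rightarrow> real^'m^'n \<Rightarrow> complex^'r \<Rightarrow> complex^'m^'n" where
  "residual t K \<alpha> = cmatrix K - Phi t \<alpha> ** pseudoinverse (Phi t \<alpha>) ** cmatrix K"

text \<open>The energy is meaningful for \<open>K \<in> sign_set H\<close> only; the value \<open>\<infinity>\<close> outside
  \<open>sign_set H\<close> is a dummy.\<close>

definition energy ::
    "('n::finite \<Rightarrow> real) \<Rightarrow> real^'m^'n \<Rightarrow> real \<Rightarrow> real^'m^'n \<Rightarrow> complex^'r \<Rightarrow> ereal" where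
  "energy t H \<eta> K \<alpha> =
     (if K \<in> strict_sign_set H
      then ereal ((\<Sum>(n, m) \<in> {(n, m). H $ n $ m \<noteq> 0}.
                     ln \<bar>K $ n $ m\<bar> + H $ n $ m / K $ n $ m)
                  + \<eta> / 2 * (norm (residual t K \<alpha>))\<^sup>2)
      else \<infinity>)"

definition grad_H ::
    "('n::finite \<Rightarrow> real) \<Rightarrow> real^'m^'n \<Rightarrow> real \<Rightarrow> real^'m^'n \<Rightarrow> complex^'r \<Rightarrow> real^'m^'n" where
  "grad_H t H \<eta> K \<alpha> =
     (\<chi> n m. (if H $ n $ m \<noteq> 0 then 1 / K $ n $ m - H $ n $ m / (K $ n $ m)\<^sup>2 else 0)
            + \<eta> * Re (residual t K \<alpha> $ n $ m))"

text \<open>Writing \<open>\<alpha>\<^sub>r = x\<^sub>r + \<i> y\<^sub>r\<close>, the Wirtinger derivative (\<open>\<alpha>\<close> and its conjugate treated as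
  independent) is \<open>\<partial>f/\<partial>\<alpha>\<^sub>r = (\<partial>f/\<partial>x\<^sub>r - \<i> \<partial>f/\<partial>y\<^sub>r) / 2\<close>.\<close>

definition wirtinger :: "(complex^'r \<Rightarrow> complex) \<Rightarrow> complex^'r \<Rightarrow> complex^'r" where
  "wirtinger f \<alpha> =
     (\<chi> r. (vector_derivative (\<lambda>s. f (\<alpha> + axis r (of_real s))) (at 0)
           - \<i> * vector_derivative (\<lambda>s. f (\<alpha> + axis r (\<i> * of_real s))) (at 0)) / 2)"

text \<open>The Hermitian transpose of the row vector \<open>\<partial>f/\<partial>\<alpha>\<close> is its entrywise conjugate.\<close>

definition complex_gradient :: "(complex^'r \<Rightarrow> complex) \<Rightarrow> complex^'r \<Rightarrow> complex^'r" where
  "complex_gradient f \<alpha> = (\<chi> r. 2 * cnj (wirtinger f \<alpha> $ r))"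

text \<open>\<^const>\<open>real_of_ereal\<close> only removes the type \<^typ>\<open>ereal\<close>: for \<open>K \<in> strict_sign_set H\<close> the energy
  is finite at every \<open>\<alpha>\<close>.\<close>

definition grad_\<alpha> ::
    "('n::finite \<Rightarrow> real) \<Rightarrow> real^'m^'n \<Rightarrow> real \<Rightarrow> real^'m^'n \<Rightarrow> complex^'r \<Rightarrow> complex^'r" where
  "grad_\<alpha> t H \<eta> K \<alpha> = complex_gradient (\<lambda>\<beta>. of_real (real_of_ereal (energy t H \<eta> K \<beta>))) \<alpha>"

definition trial_H ::
    "('n::finite \<Rightarrow> real) \<Rightarrow> real^'m^'n \<Rightarrow> real \<Rightarrow> real^'m^'n \<Rightarrow> complex^'r \<Rightarrow> real \<Rightarrow> real^'m^'n" where
  "trial_H t H \<eta> K \<alpha> \<tau> = closest_point (sign_set H) (K - \<tau> *\<^sub>R grad_H t H \<eta> K \<alpha>)"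

definition trial_\<alpha> ::
    "('n::finite \<Rightarrow> real) \<Rightarrow> real^'m^'n \<Rightarrow> real \<Rightarrow> real^'m^'n \<Rightarrow> complex^'r \<Rightarrow> real \<Rightarrow> complex^'r" where
  "trial_\<alpha> t H \<eta> K \<alpha> \<tau> = \<alpha> - \<tau> *\<^sub>R grad_\<alpha> t H \<eta> K \<alpha>"

definition rejected_H ::
    "('n::finite \<Rightarrow> real) \<Rightarrow> real^'m^'n \<Rightarrow> real \<Rightarrow> real^'m^'n \<Rightarrow> complex^'r \<Rightarrow> real \<Rightarrow> bool" where
  "rejected_H t H \<eta> K \<alpha> \<tau> \<longleftrightarrow>
     energy t H \<eta> (trial_H t H \<eta> K \<alpha> \<tau>) \<alpha>
       > energy t H \<eta> K \<alpha> - ereal (1 / (2 * \<tau>) * (norm (trial_H t H \<eta> K \<alpha> \<tau> - K))\<^sup>2)"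

definition rejected_\<alpha> ::
    "('n::finite \<Rightarrow> real) \<Rightarrow> real^'m^'n \<Rightarrow> real \<Rightarrow> real^'m^'n \<Rightarrow> complex^'r \<Rightarrow> real \<Rightarrow> bool" where
  "rejected_\<alpha> t H \<eta> K \<alpha> \<tau> \<longleftrightarrow>
     energy t H \<eta> K (trial_\<alpha> t H \<eta> K \<alpha> \<tau>)
       > energy t H \<eta> K \<alpha> - ereal (1 / (2 * \<tau>) * (norm (trial_\<alpha> t H \<eta> K \<alpha> \<tau> - \<alpha>))\<^sup>2)"

text \<open>Big-step semantics of a backtracking loop: \<open>backtrack rej \<tau> \<tau>'\<close> says that the loop entered
  with step size \<open>\<tau>\<close> stops, and does so with step size \<open>\<tau>'\<close>.\<close>

inductive backtrack :: "(real \<Rightarrow> bool) \<Rightarrow> real \<Rightarrow> real \<Rightarrow> bool" for rej where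
  accept: "\<not> rej \<tau> \<Longrightarrow> backtrack rej \<tau> \<tau>"
| halve: "rej \<tau> \<Longrightarrow> backtrack rej (\<tau> / 2) \<tau>' \<Longrightarrow> backtrack rej \<tau> \<tau>'"

text \<open>\<open>\<tau>H k\<close> and \<open>\<tau>\<alpha> k\<close> are the step sizes at the start of iteration \<open>k\<close>, before
  doubling.\<close>

definition alternating_descent ::
    "('n::finite \<Rightarrow> real) \<Rightarrow> real^'m^'n \<Rightarrow> real \<Rightarrow>
     (nat \<Rightarrow> real^'m^'n) \<Rightarrow> (nat \<Rightarrow> complex^'r) \<Rightarrow> (nat \<Rightarrow> real) \<Rightarrow> (nat \<Rightarrow> real) \<Rightarrow> bool" where
  "alternating_descent t H \<eta> K \<alpha> \<tau>H \<tau>\<alpha> \<longleftrightarrow>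
     K 0 \<in> strict_sign_set H \<and> \<tau>H 0 > 0 \<and> \<tau>\<alpha> 0 > 0 \<and>
     (\<forall>k. backtrack (rejected_H t H \<eta> (K k) (\<alpha> k)) (2 * \<tau>H k) (\<tau>H (Suc k)) \<and>
          K (Suc k) = trial_H t H \<eta> (K k) (\<alpha> k) (\<tau>H (Suc k)) \<and>
          backtrack (rejected_\<alpha> t H \<eta> (K (Suc k)) (\<alpha> k)) (2 * \<tau>\<alpha> k) (\<tau>\<alpha> (Suc k)) \<and>
          \<alpha> (Suc k) = trial_\<alpha> t H \<eta> (K (Suc k)) (\<alpha> k) (\<tau>\<alpha> (Suc k)))"

end

theory Submission
  imports Defs
begin

text \<open>An accepted step lowers the energy by at least the nonnegative sufficient-decrease term.
  The energy is bounded below because \<open>ln x + a / x\<close> is minimal at \<open>x = a\<close>, and the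
  initial energy is finite, so the monotone sequence has a real limit.\<close>

lemma backtrack_not_rejected:
  assumes "backtrack rej \<tau> \<tau>'"
  shows "\<not> rej \<tau>'"
  using assms by induction

lemma backtrack_pos:
  assumes "backtrack rej \<tau> \<tau>'" "\<tau> > 0"
  shows "\<tau>' > 0"
  using assms by induction auto

text \<open>This is the tangent bound \<open>ln y \<le> y - 1\<close> at \<open>y = a / x\<close>;
  the left side is the value of the right side at its minimiser \<open>x = a\<close>.\<close>

lemma ln_plus_divide_ge:
  fixes a x :: real
  assumes "a > 0" "x > 0"
  shows "ln a + 1 \<le> ln x + a / x"
  using ln_le_minus_one[of "a / x"] assms by (simp add: ln_div)

text \<open>Each summand of the data term is at least its value at \<open>K = H\<close>, and the
  penalty is dropped because it is nonnegative. The bound does not depend on \<open>K\<close> or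
  \<open>\<alpha>\<close>, so it serves for a whole sequence of iterates.\<close>

lemma energy_ge:
  assumes "\<eta> \<ge> 0"
  shows "ereal (\<Sum>(n, m) \<in> {(n, m). H $ n $ m \<noteq> 0}. ln \<bar>H $ n $ m\<bar> + 1) \<le> energy t H \<eta> K \<alpha>"
proof (cases "K \<in> strict_sign_set H")
  case True
  have "ln \<bar>H $ n $ m\<bar> + 1 \<le> ln \<bar>K $ n $ m\<bar> + H $ n $ m / K $ n $ m"
    if "H $ n $ m \<noteq> 0" for n m
  proof -
    have "K $ n $ m * H $ n $ m > 0"
      using True that by (simp add: strict_sign_set_def)
    \<comment> \<open>Equal signs turn the quotient into one of absolute values, which reduces the
      claim to positive reals.\<close>
    then have "H $ n $ m / K $ n $ m = \<bar>H $ n $ m\<bar> / \<bar>K $ n $ m\<bar>" "\<bar>K $ n $ m\<bar> > 0"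
      by (auto simp: zero_less_mult_iff)
    then show ?thesis
      using ln_plus_divide_ge[of "\<bar>H $ n $ m\<bar>" "\<bar>K $ n $ m\<bar>"] that by simp
  qed
  then have "(\<Sum>(n, m) \<in> {(n, m). H $ n $ m \<noteq> 0}. ln \<bar>H $ n $ m\<bar> + 1)
      \<le> (\<Sum>(n, m) \<in> {(n, m). H $ n $ m \<noteq> 0}. ln \<bar>K $ n $ m\<bar> + H $ n $ m / K $ n $ m)"
    by (intro sum_mono) auto
  moreover have "0 \<le> \<eta> / 2 * (norm (residual t K \<alpha>))\<^sup>2"
    using assms by simp
  ultimately show ?thesis
    using True by (simp add: energy_def)
qed (simp add: energy_def)

text \<open>The subtracted amount is real, so infinite \<open>x\<close> causes no exception and the
  acceptance tests can be used without a finiteness check.\<close>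

lemma ereal_minus_nonneg_le:
  fixes x :: ereal
  assumes "c \<ge> 0"
  shows "x - ereal c \<le> x"
  using assms by (cases x) auto

text \<open>Acceptance is a sufficient-decrease inequality; \<open>\<tau> > 0\<close> gives its
  quadratic term the right sign.\<close>

lemma energy_trial_H_le:
  assumes "\<not> rejected_H t H \<eta> K \<alpha> \<tau>" "\<tau> > 0"
  shows "energy t H \<eta> (trial_H t H \<eta> K \<alpha> \<tau>) \<alpha> \<le> energy t H \<eta> K \<alpha>"
  using assms unfolding rejected_H_def not_less
  by (elim order_trans) (intro ereal_minus_nonneg_le, simp)

lemma energy_trial_\<alpha>_le:
  assumes "\<not> rejected_\<alpha> t H \<eta> K \<alpha> \<tau>" "\<tau> > 0"
  shows "energy t H \<eta> K (trial_\<alpha> t H \<eta> K \<alpha> \<tau>) \<le> energy t H \<eta> K \<alpha>"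
  using assms unfolding rejected_\<alpha>_def not_less
  by (elim order_trans) (intro ereal_minus_nonneg_le, simp)

text \<open>Doubling and finitely many halvings preserve positivity, which is carried from one
  iteration to the next.\<close>

lemma alternating_descent_step_sizes_pos:
  assumes "alternating_descent t H \<eta> K \<alpha> \<tau>H \<tau>\<alpha>"
  shows "\<tau>H k > 0" "\<tau>\<alpha> k > 0"
proof -
  have "\<tau>H k > 0 \<and> \<tau>\<alpha> k > 0"
  proof (induction k)
    case 0
    then show ?case
      using assms by (simp add: alternating_descent_def)
  next
    case (Suc k)
    have "backtrack (rejected_H t H \<eta> (K k) (\<alpha> k)) (2 * \<tau>H k) (\<tau>H (Suc k))"
      "backtrack (rejected_\<alpha> t H \<eta> (K (Suc k)) (\<alpha> k)) (2 * \<tau>\<alpha> k) (\<tau>\<alpha> (Suc k))"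
      using assms unfolding alternating_descent_def by blast+
    then show ?case
      using Suc backtrack_pos by (metis mult_pos_pos zero_less_numeral)
  qed
  then show "\<tau>H k > 0" "\<tau>\<alpha> k > 0"
    by simp_all
qed

lemma energy_alternating_descent_Suc_le:
  assumes "alternating_descent t H \<eta> K \<alpha> \<tau>H \<tau>\<alpha>"
  shows "energy t H \<eta> (K (Suc k)) (\<alpha> (Suc k)) \<le> energy t H \<eta> (K k) (\<alpha> k)"
proof -
  \<comment> \<open>Iteration \<open>k\<close> accepts the step sizes with index
    \<open>Suc k\<close>.\<close>
  note pos = alternating_descent_step_sizes_pos[OF assms, of "Suc k"]
  have H: "backtrack (rejected_H t H \<eta> (K k) (\<alpha> k)) (2 * \<tau>H k) (\<tau>H (Suc k))"
      "K (Suc k) = trial_H t H \<eta> (K k) (\<alpha> k) (\<tau>H (Suc k))"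
    and \<alpha>: "backtrack (rejected_\<alpha> t H \<eta> (K (Suc k)) (\<alpha> k)) (2 * \<tau>\<alpha> k) (\<tau>\<alpha> (Suc k))"
      "\<alpha> (Suc k) = trial_\<alpha> t H \<eta> (K (Suc k)) (\<alpha> k) (\<tau>\<alpha> (Suc k))"
    using assms unfolding alternating_descent_def by blast+
  \<comment> \<open>The two half steps meet at the intermediate pair \<open>K (Suc k)\<close>,
    \<open>\<alpha> k\<close>.\<close>
  have "energy t H \<eta> (K (Suc k)) (\<alpha> (Suc k)) \<le> energy t H \<eta> (K (Suc k)) (\<alpha> k)"
    using energy_trial_\<alpha>_le[OF backtrack_not_rejected[OF \<alpha>(1)] pos(2)] \<alpha>(2) by simp
  also have "\<dots> \<le> energy t H \<eta> (K k) (\<alpha> k)"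
    using energy_trial_H_le[OF backtrack_not_rejected[OF H(1)] pos(1)] H(2) by simp
  finally show ?thesis .
qed

text \<open>In \<open>ereal\<close> a decreasing sequence always tends to its infimum;
  \<open>c\<close> and \<open>X 0\<close> exclude the two infinite values.\<close>

lemma decseq_ereal_convergent_real:
  fixes X :: "nat \<Rightarrow> ereal"
  assumes "decseq X" "X 0 < \<infinity>" "\<And>k. ereal c \<le> X k"
  shows "\<exists>L::real. X \<longlonglongrightarrow> ereal L"
proof -
  have "ereal c \<le> (INF k. X k)"
    using assms(3) by (intro INF_greatest)
  moreover have "(INF k. X k) < \<infinity>"
    using assms(2) by (meson INF_lower UNIV_I le_less_trans)
  ultimately obtain L where "(INF k. X k) = ereal L"
    by (cases "INF k. X k") auto
  then show ?thesis
    using LIMSEQ_INF[OF assms(1)] by auto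
qed

theorem proposition4p4:
  fixes t :: "'n::{finite,linorder} \<Rightarrow> real"
    and H :: "real^'m^'n::{finite,linorder}"
    and \<eta> :: real
    and Ht :: "nat \<Rightarrow> real^'m^'n::{finite,linorder}"
    and \<alpha> :: "nat \<Rightarrow> complex^'r"
    and \<tau>H \<tau>\<alpha> :: "nat \<Rightarrow> real"
  assumes "strict_mono t"
    and "\<eta> > 0"
    and "alternating_descent t H \<eta> Ht \<alpha> \<tau>H \<tau>\<alpha>"
    and "\<And>k. inj (\<lambda>r. \<alpha> k $ r)"
  shows "(\<forall>k. energy t H \<eta> (Ht (Suc k)) (\<alpha> (Suc k)) \<le> energy t H \<eta> (Ht k) (\<alpha> k)) \<and>
         (\<exists>L::real. (\<lambda>k. energy t H \<eta> (Ht k) (\<alpha> k)) \<longlonglongrightarrow> ereal L)"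
proof
  show decreasing:
    "\<forall>k. energy t H \<eta> (Ht (Suc k)) (\<alpha> (Suc k)) \<le> energy t H \<eta> (Ht k) (\<alpha> k)"
    using energy_alternating_descent_Suc_le[OF assms(3)] by blast
  \<comment> \<open>The strictly signed start makes the first energy finite, which keeps the limit
    below \<infinity>.\<close>
  have "Ht 0 \<in> strict_sign_set H"
    using assms(3) by (simp add: alternating_descent_def)
  then have "energy t H \<eta> (Ht 0) (\<alpha> 0) < \<infinity>"
    by (simp add: energy_def)
  moreover have "decseq (\<lambda>k. energy t H \<eta> (Ht k) (\<alpha> k))"
    using decreasing by (simp add: decseq_Suc_iff)
  ultimately show "\<exists>L::real. (\<lambda>k. energy t H \<eta> (Ht k) (\<alpha> k)) \<longlonglongrightarrow> ereal L"
    using decseq_ereal_convergent_real energy_ge[OF less_imp_le[OF assms(2)]] by blast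
qed

end
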